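(* Let $k_0\in\mathbb{N}$ be an arbitrary fixed number, let $k\le k_0$ be a positive integer, and let $\varphi_1$ be the Jacob's ladder with iterates $\varphi_1^r$ and reversely iterated segments $[\overset{q}{T},\overset{q}{\overbrace{T+\ln^{-p}T}}]$. Then for all $p,q\in\{1,\dots,k\}$, $$\int_{\overset{q}{T}}^{\overset{q}{\overbrace{T+\ln^{-p}T}}}\ \prod_{r=0}^{q-1}\left|\zeta\left(\tfrac12+i\varphi_1^r(t)\right)\right|^2\,dt\ \sim\ \ln^{q-p}T,\qquad T\to\infty,$$ where, for $t$ in the segment of integration, $\varphi_1^r(t)\in[\overset{q-r}{T},\overset{q-r}{\overbrace{T+\ln^{-p}T}}]$ for $r=0,1,\dots,q$.
   Context: $\zeta$ is the Riemann zeta-function; $\ln^{m}T=(\ln T)^m$; $f(T)\sim g(T)$ means $f(T)/g(T)\to1$ as $T\to\infty$. Jacob's ladder. Let $Z(t)=e^{i\vartheta(t)}\zeta(\frac12+it)$ with $\vartheta(t)=-\frac t2\ln\pi+\operatorname{Im}\ln\Gamma(\frac14+i\frac t2)$, so $Z^2(t)=|\zeta(\frac12+it)|^2$. Fix a smooth increasing unbounded function $\mu$ with $\mu(y)\ge 7y\ln y$, and let $\varphi(T)$ be the solution (for all large $T$) of $$\int_0^{\mu[\varphi(T)]}Z^2(t)e^{-\frac{2}{\varphi(T)}t}\,dt=\int_0^TZ^2(t)\,dt .$$ The Jacob's ladder is $\varphi_1(t)=\frac12\varphi(t)$. The following known properties of $\varphi_1$ are standing facts: on some half-line $[T_0,\infty)$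 it is continuously differentiable, strictly increasing and unbounded, $t-\varphi_1(t)\sim(1-c)\frac{t}{\ln t}$ as $t\to\infty$ ($c$ Euler's constant), and $$\frac{d\varphi_1(t)}{dt}=\frac{|\zeta(\frac12+it)|^2}{\omega(t)},\qquad \omega(t)=\left\{1+O\left(\frac{\ln\ln t}{\ln t}\right)\right\}\ln t .$$ Iterates: $\varphi_1^0(t)=t$, $\varphi_1^1(t)=\varphi_1(t)$, $\varphi_1^2(t)=\varphi_1(\varphi_1(t))$, and so on (the upper index denotes composition). Reverse iterates: for large $x$, $\overset{0}{x}=x$ and $\overset{q}{x}$ is determined by $\varphi_1(\overset{q}{x})=\overset{q-1}{x}$, i.e. $\overset{q}{x}$ is the $q$-fold iterate of the inverse function of $\varphi_1$ at $x$. In particular $\overset{q}{T}$ and $\overset{q}{\overbrace{T+\ln^{-p}T}}$ are the $q$-th reverse iterates of $T$ and of $T+\ln^{-p}T$, so that $\varphi_1$ maps $[\overset{q}{T},\overset{q}{\overbrace{T+\ln^{-p}T}}]$ onto $[\overset{q-1}{T},\overset{q-1}{\overbrace{T+\ln^{-p}T}}]$. *)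

theory Defs
  imports "HOL-Complex_Analysis.Complex_Analysis" "HOL-Library.Landau_Symbols"
begin

(* The analytic continuation of the Dirichlet series to the plane without 1.  Two candidates can
   differ only at the pole s = 1, where the value is unspecified. *)
definition zeta :: "complex \<Rightarrow> complex" where
  "zeta = (SOME f. f holomorphic_on (- {1}) \<and>
             (\<forall>s. Re s > 1 \<longrightarrow> (\<lambda>n. 1 / (of_nat (Suc n) powr s)) sums f s))"

(* ln_Gamma is the branch of log Gamma on the right half-plane that is real on the positive
   axis. *)
definition theta :: "real \<Rightarrow> real" where
  "theta t = - (t / 2) * ln pi + Im (ln_Gamma (1/4 + \<i> * complex_of_real (t / 2)))"

(* Complex-valued as defined; that Z t is real for real t is a consequence of the functional
   equation and is not built in. *)
definition hardy_Z :: "real \<Rightarrow> complex" where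
  "hardy_Z t = exp (\<i> * complex_of_real (theta t)) * zeta (1/2 + \<i> * complex_of_real t)"

definition admissible_mu :: "(real \<Rightarrow> real) \<Rightarrow> bool" where
  "admissible_mu \<mu> \<longleftrightarrow> (\<exists>y0>0.
     (\<forall>n. (deriv ^^ n) \<mu> differentiable_on {y0<..}) \<and>
     mono_on {y0<..} \<mu> \<and>
     filterlim \<mu> at_top at_top \<and>
     (\<forall>y>y0. \<mu> y \<ge> 7 * y * ln y))"

definition ladder_equation :: "(real \<Rightarrow> real) \<Rightarrow> (real \<Rightarrow> real) \<Rightarrow> real \<Rightarrow> bool" where
  "ladder_equation \<mu> \<phi> T \<longleftrightarrow> \<phi> T > 0 \<and>
     integral {0..\<mu> (\<phi> T)}
       (\<lambda>t. (hardy_Z t)\<^sup>2 * complex_of_real (exp (- (2 / \<phi> T) * t))) =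
     integral {0..T} (\<lambda>t. (hardy_Z t)\<^sup>2)"

definition jacobs_ladder :: "(real \<Rightarrow> real) \<Rightarrow> real \<Rightarrow> real" where
  "jacobs_ladder \<phi> t = \<phi> t / 2"

(* The known properties of Jacob's ladder on the half-line from T0 that are taken for granted. *)
definition ladder_standing_facts :: "real \<Rightarrow> (real \<Rightarrow> real) \<Rightarrow> bool" where
  "ladder_standing_facts T0 \<phi>1 \<longleftrightarrow>
     strict_mono_on {T0..} \<phi>1 \<and>
     filterlim \<phi>1 at_top at_top \<and>
     (\<lambda>t. t - \<phi>1 t) \<sim>[at_top] (\<lambda>t. (1 - euler_mascheroni) * (t / ln t)) \<and>
     (\<exists>\<phi>1' \<omega>.
        continuous_on {T0..} \<phi>1' \<and>
        (\<forall>t\<ge>T0. (\<phi>1 has_real_derivative \<phi>1' t) (at t within {T0..})) \<and>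
        (\<forall>t\<ge>T0. \<phi>1' t = (cmod (zeta (1/2 + \<i> * complex_of_real t)))\<^sup>2 / \<omega> t) \<and>
        (\<lambda>t. \<omega> t / ln t - 1) \<in> O[at_top](\<lambda>t. ln (ln t) / ln t))"

(* The q-fold iterate of the inverse of the ladder.  The inverse is taken on the half-line from T0,
   where the ladder is injective; below T0 its values are irrelevant. *)
definition reverse_iterate :: "real \<Rightarrow> (real \<Rightarrow> real) \<Rightarrow> nat \<Rightarrow> real \<Rightarrow> real" where
  "reverse_iterate T0 \<phi>1 q = inv_into {T0..} \<phi>1 ^^ q"

definition reverse_segment :: "real \<Rightarrow> (real \<Rightarrow> real) \<Rightarrow> nat \<Rightarrow> nat \<Rightarrow> real \<Rightarrow> real set" where
  "reverse_segment T0 \<phi>1 p q T =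
     {reverse_iterate T0 \<phi>1 q T .. reverse_iterate T0 \<phi>1 q (T + ln T powi (- int p))}"

end

theory Submission
  imports Defs "HOL-Real_Asymp.Real_Asymp"
begin

text \<open>
  On the segment \<open>[a, b]\<close> obtained by \<open>q\<close> reverse iterations, the derivative of \<open>\<phi>1 ^^ q\<close> is by the
  chain rule the integrand divided by \<open>\<Prod>r<q. \<omega> ((\<phi>1 ^^ r) t)\<close>, and it integrates to \<open>ln T powi (- p)\<close>.
  Since \<open>ln (\<phi>1 t)\<close> is asymptotic to \<open>ln t\<close>, all factors of that product are asymptotic to \<open>ln T\<close>,
  uniformly on the segment, so the product contributes \<open>ln T ^ q\<close>.

  Integrability of the integrand rests on the continuity of \<open>zeta\<close> on the critical line, hence on the
  existence of the analytic continuation.  With \<open>G s = (s - 1) * (zeta s - 1)\<close>, summing the binomial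
  series of \<open>(m + 1) powr (1 - s)\<close> in powers of \<open>1 / m\<close> over \<open>m \<ge> 2\<close> gives
  \<open>G s = 2 powr (1 - s) + (\<Sum>j. c j s * G (s + j + 1))\<close> with polynomials \<open>c j\<close>, whose right-hand side
  makes sense one unit further to the left than \<open>G\<close> does.
\<close>

subsection \<open>Analytic continuation of the zeta function\<close>

text \<open>The product bound makes the double family absolutely summable, so it may be summed by
  rows or by columns. It serves to exchange the binomial expansion with the sum over the
  bases.\<close>

lemma sums_swap_of_product_bound:
  fixes f :: "nat \<Rightarrow> nat \<Rightarrow> 'a :: banach" and A B :: "nat \<Rightarrow> real"
  assumes bound: "\<And>m j. norm (f m j) \<le> A m * B j"
    and A: "summable A" "\<And>m. 0 \<le> A m" and B: "summable B" "\<And>j. 0 \<le> B j"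
  shows "(\<lambda>j. \<Sum>m. f m j) sums (\<Sum>m. \<Sum>j. f m j)"
proof -
  have hB: "(B has_sum suminf B) UNIV"
    using B by (intro norm_summable_imp_has_sum summable_sums) auto
  have AB: "(\<lambda>(m, j). A m * B j) summable_on UNIV \<times> UNIV"
  proof (rule summable_on_SigmaI)
    show "((\<lambda>j. case (m, j) of (m, j) \<Rightarrow> A m * B j) has_sum (A m * suminf B)) UNIV" for m
      using has_sum_cmult_right[OF hB] by simp
    show "(\<lambda>m. A m * suminf B) summable_on UNIV"
      using A B by (intro summable_on_cmult_left) (simp add: summable_on_UNIV_nonneg_real_iff)
  qed (use A B in auto)
  have f: "(\<lambda>(m, j). f m j) summable_on UNIV \<times> UNIV"
    by (rule abs_summable_summable, rule summable_on_comparison_test[OF AB]) (use bound in auto)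
  then obtain S where S: "((\<lambda>(m, j). f m j) has_sum S) (UNIV \<times> UNIV)"
    by (auto simp: summable_on_def)
  have rows: "((\<lambda>j. f m j) has_sum (\<Sum>j. f m j)) UNIV" for m
  proof (rule norm_summable_imp_has_sum)
    show *: "summable (\<lambda>j. norm (f m j))"
      by (rule summable_comparison_test[OF _ summable_mult[OF B(1), of "A m"]])
         (use bound in auto)
    show "(\<lambda>j. f m j) sums (\<Sum>j. f m j)"
      using summable_norm_cancel[OF *] by (rule summable_sums)
  qed
  have cols: "((\<lambda>m. f m j) has_sum (\<Sum>m. f m j)) UNIV" for j
  proof (rule norm_summable_imp_has_sum)
    show *: "summable (\<lambda>m. norm (f m j))"
      by (rule summable_comparison_test[OF _ summable_mult2[OF A(1), of "B j"]])
         (use bound in auto)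
    show "(\<lambda>m. f m j) sums (\<Sum>m. f m j)"
      using summable_norm_cancel[OF *] by (rule summable_sums)
  qed
  have "((\<lambda>m. \<Sum>j. f m j) has_sum S) UNIV"
    by (rule has_sum_SigmaD[OF S]) (use rows in auto)
  then have eq: "S = (\<Sum>m. \<Sum>j. f m j)"
    by (intro sums_unique has_sum_imp_sums)
  have "((\<lambda>(j, m). f m j) has_sum S) (UNIV \<times> UNIV)"
    using S by (subst (asm) has_sum_swap) auto
  then have "((\<lambda>j. \<Sum>m. f m j) has_sum S) UNIV"
    by (rule has_sum_SigmaD) (use cols in auto)
  then show ?thesis
    unfolding eq by (rule has_sum_imp_sums)
qed

text \<open>This is \<open>zeta s - 1\<close> on \<open>Re s > 1\<close>. Without the term 1 all
  bases are at least 2, so their reciprocals lie inside the disc of the binomial series and the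
  values decay exponentially in \<open>Re s\<close>.\<close>

definition zeta_tail :: "complex \<Rightarrow> complex" where
  "zeta_tail s = (\<Sum>n. of_nat (n + 2) powr (- s))"

lemma norm_nat_powr: "norm (of_nat n powr s :: complex) = real n powr Re s"
  by (subst norm_powr_real_powr) auto

lemma summable_nat_powr_tail:
  assumes "\<sigma> > 1"
  shows "summable (\<lambda>n. real (n + 2) powr (- \<sigma>))"
  using summable_iff_shift[of "\<lambda>n. real n powr (- \<sigma>)" 2] summable_real_powr_iff[of "- \<sigma>"] assms
  by (simp add: add.commute)

lemma zeta_tail_sums:
  assumes "Re s > 1"
  shows "(\<lambda>n. of_nat (n + 2) powr (- s)) sums zeta_tail s"
proof -
  have "summable (\<lambda>n. norm (of_nat (n + 2) powr (- s) :: complex))"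
    using summable_nat_powr_tail[OF assms] by (simp only: norm_nat_powr uminus_complex.sel)
  then show ?thesis
    unfolding zeta_tail_def by (rule summable_sums[OF summable_norm_cancel])
qed

lemma zeta_tail_holomorphic: "zeta_tail holomorphic_on {s. Re s > 1}"
proof (rule holomorphic_uniform_sequence)
  show "open {s. 1 < Re s}" by (rule open_halfspace_Re_gt)
  show "(\<lambda>s. \<Sum>i<n. of_nat (i + 2) powr (- s)) holomorphic_on {s. 1 < Re s}" for n
    by (intro holomorphic_intros)
  fix s assume "s \<in> {s. 1 < Re s}"
  then have s: "Re s > 1" by simp
  \<comment> \<open>Half the distance to the line of real part 1, so that one convergent real series
    dominates on the whole closed disc.\<close>
  define d where "d = (Re s - 1) / 2"
  have d: "d > 0" "1 < Re s - d" using s by (auto simp: d_def field_simps)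
  have near: "Re s - d \<le> Re z" if "z \<in> cball s d" for z
    using that abs_Re_le_cmod[of "s - z"] by (auto simp: dist_norm)
  have "uniform_limit (cball s d) (\<lambda>n s. \<Sum>i<n. of_nat (i + 2) powr (- s)) zeta_tail sequentially"
    unfolding zeta_tail_def[abs_def]
  proof (rule Weierstrass_m_test[OF _ summable_nat_powr_tail[OF d(2)]])
    fix n z assume "z \<in> cball s d"
    then show "norm (of_nat (n + 2) powr (- z) :: complex) \<le> real (n + 2) powr (- (Re s - d))"
      using near[of z] norm_nat_powr[of "n + 2" "- z"] by (auto intro!: powr_mono)
  qed
  moreover have "cball s d \<subseteq> {s. 1 < Re s}"
    using near d by fastforce
  ultimately show "\<exists>d>0. cball s d \<subseteq> {s. 1 < Re s} \<and>
      uniform_limit (cball s d) (\<lambda>n s. \<Sum>i<n. of_nat (i + 2) powr (- s)) zeta_tail sequentially"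
    using d by blast
qed

text \<open>Two powers of the base are kept for convergence over \<open>n\<close>; the rest is
  largest at base 2. This geometric decay drives the convergence of the series in
  \<open>tail_ext\<close>.\<close>

lemma zeta_tail_bound:
  obtains C where "C \<ge> 0" "\<And>s. Re s \<ge> 2 \<Longrightarrow> norm (zeta_tail s) \<le> C * 2 powr (- Re s)"
proof
  define C where "C = 4 * (\<Sum>n. real (n + 2) powr (- 2))"
  show "C \<ge> 0"
    unfolding C_def using summable_nat_powr_tail[of 2] by (intro mult_nonneg_nonneg suminf_nonneg) auto
  fix s :: complex assume s: "Re s \<ge> 2"
  have le: "norm (of_nat (n + 2) powr (- s) :: complex)
      \<le> real (n + 2) powr (- 2) * (4 * 2 powr (- Re s))" for n
  proof -
    have "norm (of_nat (n + 2) powr (- s) :: complex) = real (n + 2) powr (- 2 + (2 - Re s))"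
      using norm_nat_powr[of "n + 2" "- s"] by simp
    also have "\<dots> = real (n + 2) powr (- 2) * real (n + 2) powr (2 - Re s)"
      by (rule powr_add)
    also have "\<dots> \<le> real (n + 2) powr (- 2) * 2 powr (2 - Re s)"
      using s by (intro mult_left_mono powr_mono2') auto
    also have "(2::real) powr (2 - Re s) = 4 * 2 powr (- Re s)"
      by (simp add: powr_diff powr_minus divide_inverse)
    finally show ?thesis .
  qed
  have "norm (zeta_tail s) \<le> (\<Sum>n. real (n + 2) powr (- 2) * (4 * 2 powr (- Re s)))"
    unfolding zeta_tail_def
    by (rule norm_suminf_le[OF le]) (intro summable_mult2 summable_nat_powr_tail, simp)
  also have "\<dots> = C * 2 powr (- Re s)"
    unfolding C_def by (subst suminf_mult2[symmetric]) (use summable_nat_powr_tail[of 2] in auto)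
  finally show "norm (zeta_tail s) \<le> C * 2 powr (- Re s)" .
qed

text \<open>
  The binomial coefficient of \<open>1 - s\<close> over \<open>j + 2\<close> with its factor \<open>s + j\<close> removed.  That factor cancels
  the pole of \<open>zeta\<close> at \<open>s + j + 1 = 1\<close>, so the continuation step never divides.
\<close>
definition shift_coeff :: "nat \<Rightarrow> complex \<Rightarrow> complex" where
  "shift_coeff j s = (- 1) ^ j * pochhammer (s - 1) (j + 1) / fact (j + 2)"

text \<open>Level \<open>n\<close> is meant to represent \<open>(s - 1) * (zeta s - 1)\<close> on
  \<open>Re s > 1 - real n\<close>; its values elsewhere carry no information. Each level evaluates
  the previous one only at \<open>s + 1\<close>, \<open>s + 2\<close> and so on, hence gains one
  unit.\<close>

primrec tail_ext :: "nat \<Rightarrow> complex \<Rightarrow> complex" where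
  "tail_ext 0 s = (s - 1) * zeta_tail s"
| "tail_ext (Suc n) s = 2 powr (1 - s) + (\<Sum>j. shift_coeff j s * tail_ext n (s + of_nat (j + 1)))"

text \<open>The removed factor is the last one of \<open>pochhammer (s - 1) (j + 2)\<close>, and a
  shift of the order by 2 preserves the sign.\<close>

lemma shift_coeff_mult: "shift_coeff j s * (s + of_nat j) = (1 - s) gchoose (j + 2)"
proof -
  have "pochhammer (s - 1) (j + 2) = (s + of_nat j) * pochhammer (s - 1) (j + 1)"
    using pochhammer_rec'[of "s - 1" "j + 1"] by (simp add: algebra_simps)
  then show ?thesis
    unfolding shift_coeff_def gbinomial_pochhammer by (simp add: mult_ac)
qed

text \<open>The binomial series has radius of convergence at least 1, and 1/2 is the largest
  reciprocal base that occurs.\<close>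

lemma summable_norm_gbinomial_half:
  fixes a :: "'a :: {real_normed_field, banach}"
  shows "summable (\<lambda>j. norm (a gchoose j) * (1/2) ^ j)"
proof -
  have "summable (\<lambda>j. norm ((a gchoose j) * (of_real (1/2)) ^ j))"
    by (rule abs_summable_in_conv_radius)
       (auto simp: conv_radius_gchoose one_ereal_def simp del: ereal_eq_1)
  then show ?thesis
    by (simp add: norm_mult norm_power norm_divide power_divide)
qed

text \<open>Expand \<open>(m + 3) powr (1 - s)\<close> around \<open>m + 2\<close> and sum over
  \<open>m\<close>. By rows the differences telescope and the linear term gives the tail; by columns
  the orders from 2 on give the shifted values.\<close>

lemma tail_ext_functional_equation:
  assumes s: "Re s > 1"
  shows "tail_ext (Suc 0) s = tail_ext 0 s"
proof -
  define f where "f m j = (1 - s gchoose (j + 2)) * of_nat (m + 2) powr (- s - of_nat (j + 1))"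
    for m j :: nat
  have row: "(\<lambda>j. f m j) sums (of_nat (m + 3) powr (1 - s) - of_nat (m + 2) powr (1 - s)
      + (s - 1) * of_nat (m + 2) powr (- s))" for m
  proof -
    have "(\<lambda>n. (1 - s gchoose n) * of_real 1 ^ n * of_real (real (m + 2)) powr (1 - s - of_nat n))
        sums of_real (1 + real (m + 2)) powr (1 - s)"
      by (rule gen_binomial_complex') auto
    \<comment> \<open>Orders 0 and 1 move to the right-hand side, which is why \<open>j\<close>
      stands for order \<open>j + 2\<close>.\<close>
    from sums_split_initial_segment[OF this, of 2]
    have "(\<lambda>n. (1 - s gchoose (n + 2)) * of_nat (m + 2) powr (1 - s - of_nat (n + 2)))
        sums (of_nat (m + 3) powr (1 - s) - of_nat (m + 2) powr (1 - s)
          - (1 - s) * of_nat (m + 2) powr (1 - s - 1))"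
      by (simp add: lessThan_Suc eval_nat_numeral algebra_simps)
    moreover have "1 - s - of_nat (n + 2) = - s - of_nat (n + 1)" for n
      by simp
    ultimately show ?thesis
      unfolding f_def by (simp only:) (simp add: algebra_simps)
  qed
  \<comment> \<open>Bounding the base below by 2 in the power that depends on \<open>j\<close>
    separates the variables, as the exchange of sums requires.\<close>
  have bound: "norm (f m j) \<le> real (m + 2) powr (- Re s)
      * (norm (1 - s gchoose (j + 2)) * (1/2) ^ (j + 1))" for m j
  proof -
    have "norm (of_nat (m + 2) powr (- s - of_nat (j + 1)) :: complex)
        = real (m + 2) powr (- Re s) * real (m + 2) powr (- real (j + 1))"
    proof -
      have "Re (- s - of_nat (j + 1)) = - Re s + - real (j + 1)" by simp
      with norm_nat_powr[of "m + 2" "- s - of_nat (j + 1)"] show ?thesis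
        by (simp only: powr_add[symmetric])
    qed
    also have "\<dots> \<le> real (m + 2) powr (- Re s) * 2 powr (- real (j + 1))"
      by (intro mult_left_mono powr_mono2') auto
    also have "(2::real) powr (- real (j + 1)) = (1/2) ^ (j + 1)"
      by (subst powr_minus, subst powr_realpow) (simp_all add: power_divide field_simps)
    finally have "norm (of_nat (m + 2) powr (- s - of_nat (j + 1)) :: complex)
        \<le> real (m + 2) powr (- Re s) * (1/2) ^ (j + 1)" .
    from mult_left_mono[OF this, of "norm (1 - s gchoose (j + 2))"] show ?thesis
      unfolding f_def by (simp add: norm_mult mult_ac)
  qed
  have sumB: "summable (\<lambda>j. norm (1 - s gchoose (j + 2)) * (1/2) ^ (j + 1))"
  proof -
    have "summable (\<lambda>j. 2 * (norm (1 - s gchoose (j + 2)) * (1/2) ^ (j + 2)))"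
      using summable_norm_gbinomial_half[of "1 - s"]
      by (intro summable_mult) (rule summable_ignore_initial_segment)
    then show ?thesis by (simp add: mult_ac)
  qed
  have "(\<lambda>j. \<Sum>m. f m j) sums (\<Sum>m. \<Sum>j. f m j)"
    by (rule sums_swap_of_product_bound[OF bound summable_nat_powr_tail[OF s] _ sumB]) auto
  \<comment> \<open>\<open>tail_ext 0\<close> at \<open>s + j + 1\<close> brings its own factor
    \<open>s + j\<close>, which completes \<open>shift_coeff\<close> to the binomial
    coefficient.\<close>
  moreover have "(\<Sum>m. f m j) = shift_coeff j s * tail_ext 0 (s + of_nat (j + 1))" for j
  proof -
    have "(\<lambda>m. of_nat (m + 2) powr (- (s + of_nat (j + 1)))) sums zeta_tail (s + of_nat (j + 1))"
      by (rule zeta_tail_sums) (use s in simp)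
    from sums_mult[OF this, of "1 - s gchoose (j + 2)"]
    moreover have "- (s + of_nat (j + 1)) = - s - of_nat (j + 1)" by simp
    ultimately have "(\<lambda>m. f m j) sums ((1 - s gchoose (j + 2)) * zeta_tail (s + of_nat (j + 1)))"
      unfolding f_def by (simp only:)
    then have "(\<Sum>m. f m j) = (1 - s gchoose (j + 2)) * zeta_tail (s + of_nat (j + 1))"
      by (rule sums_unique[symmetric])
    moreover have "shift_coeff j s * tail_ext 0 (s + of_nat (j + 1))
        = shift_coeff j s * (s + of_nat j) * zeta_tail (s + of_nat (j + 1))"
      by simp
    ultimately show ?thesis
      unfolding shift_coeff_mult by (simp only:)
  qed
  ultimately have "(\<lambda>j. shift_coeff j s * tail_ext 0 (s + of_nat (j + 1))) sums (\<Sum>m. \<Sum>j. f m j)"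
    by simp
  moreover have "(\<Sum>m. \<Sum>j. f m j) = (s - 1) * zeta_tail s - 2 powr (1 - s)"
  proof -
    \<comment> \<open>Since \<open>Re s > 1\<close>, telescoping leaves only the initial term at
      base 2.\<close>
    have "(\<lambda>m. of_nat (m + 2) powr (1 - s) :: complex) \<longlonglongrightarrow> 0"
    proof (rule Lim_null_comparison)
      show "\<forall>\<^sub>F m in sequentially. norm (of_nat (m + 2) powr (1 - s) :: complex)
          \<le> real (m + 2) powr (1 - Re s)"
        by (intro always_eventually) (simp only: norm_nat_powr minus_complex.sel one_complex.sel order_refl simp_thms)
      show "(\<lambda>m. real (m + 2) powr (1 - Re s)) \<longlonglongrightarrow> 0"
        using s by (intro tendsto_neg_powr filterlim_compose[OF filterlim_real_sequentially]
          filterlim_add_const_nat_at_top) auto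
    qed
    from telescope_sums[OF this]
    have "(\<lambda>m. of_nat (m + 3) powr (1 - s) - of_nat (m + 2) powr (1 - s) :: complex)
        sums (- (2 powr (1 - s)))"
      by (simp add: eval_nat_numeral)
    from sums_add[OF this sums_mult[OF zeta_tail_sums[OF s], of "s - 1"]]
    have "(\<lambda>m. \<Sum>j. f m j) sums (- (2 powr (1 - s)) + (s - 1) * zeta_tail s)"
      using row[THEN sums_unique] by simp
    then show ?thesis
      by (simp add: sums_iff)
  qed
  ultimately show ?thesis
    by (simp add: sums_iff)
qed

lemma norm_pochhammer_le:
  fixes z :: "'a :: {real_normed_algebra_1, comm_ring_1}"
  assumes "norm z \<le> r"
  shows "norm (pochhammer z n) \<le> pochhammer r n"
proof (induction n)
  case (Suc n)
  have "0 \<le> r" using assms norm_ge_zero order_trans by blast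
  have "norm (pochhammer z (Suc n)) \<le> norm (z + of_nat n) * norm (pochhammer z n)"
    by (simp add: pochhammer_rec' norm_mult_ineq)
  also have "\<dots> \<le> (r + real n) * pochhammer r n"
    using assms norm_triangle_ineq[of z "of_nat n"] \<open>0 \<le> r\<close> Suc.IH
    by (intro mult_mono) auto
  finally show ?case by (simp add: pochhammer_rec')
qed simp

text \<open>On the disc the Pochhammer factor is dominated by a binomial coefficient of
  \<open>- (R + 1)\<close> and the tail contributes powers of 1/2, which leaves a binomial series at
  1/2. The condition on \<open>j\<close> moves the argument to real part at least 2, where the
  exponential bound holds.\<close>

lemma tail_ext_series_majorant:
  fixes R :: real
  assumes "R \<ge> 0"
  obtains M where "summable M"
    "\<And>j s. norm s \<le> R \<Longrightarrow> R + 1 \<le> real j \<Longrightarrow>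
       norm (shift_coeff j s * tail_ext 0 (s + of_nat (j + 1))) \<le> M j"
proof -
  obtain C where C: "C \<ge> 0" "\<And>s. Re s \<ge> 2 \<Longrightarrow> norm (zeta_tail s) \<le> C * 2 powr (- Re s)"
    using zeta_tail_bound by blast
  \<comment> \<open>\<open>R + 1\<close> comes from the linear factor \<open>s + j\<close>, and
    \<open>C * 2 powr R\<close> from the tail estimate.\<close>
  define K where "K = (R + 1) * C * 2 powr R"
  define M where "M j = K * (norm (- (R + 1) gchoose (j + 1)) * (1/2) ^ (j + 1))" for j
  have "summable M"
    unfolding M_def using summable_norm_gbinomial_half[of "- (R + 1)"]
    by (intro summable_mult) (use summable_ignore_initial_segment in blast)
  moreover have "norm (shift_coeff j s * tail_ext 0 (s + of_nat (j + 1))) \<le> M j"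
    if s: "norm s \<le> R" and j: "R + 1 \<le> real j" for j s
  proof -
    have Re_s: "- R \<le> Re s" using s abs_Re_le_cmod[of s] by linarith
    have "norm (s - 1) \<le> R + 1"
      using s norm_triangle_ineq4[of s 1] by simp
    then have poch: "norm (pochhammer (s - 1) (j + 1)) \<le> pochhammer (R + 1) (j + 1)"
      by (rule norm_pochhammer_le)
    \<comment> \<open>The factor \<open>j + 2\<close> is split off to reduce
      \<open>fact (j + 2)\<close> to \<open>fact (j + 1)\<close>.\<close>
    have lin: "norm (s + of_nat j) \<le> (R + 1) * real (j + 2)"
    proof -
      have "norm (s + of_nat j) \<le> R + real j"
        using s norm_triangle_ineq[of s "of_nat j"] by simp
      also have "\<dots> \<le> (R + 1) * real (j + 2)"
        using \<open>R \<ge> 0\<close> by (simp add: algebra_simps)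
      finally show ?thesis .
    qed
    have tail: "norm (zeta_tail (s + of_nat (j + 1))) \<le> C * (2 powr R * (1/2) ^ (j + 1))"
    proof -
      have "norm (zeta_tail (s + of_nat (j + 1))) \<le> C * 2 powr (- Re s - real (j + 1))"
      proof -
        have "- Re (s + of_nat (j + 1)) = - Re s - real (j + 1)" by simp
        with C(2)[of "s + of_nat (j + 1)"] Re_s j show ?thesis by (simp del: of_nat_add of_nat_Suc)
      qed
      also have "\<dots> \<le> C * 2 powr (R - real (j + 1))"
        using Re_s C(1) by (intro mult_left_mono powr_mono) auto
      also have "(2::real) powr (R - real (j + 1)) = 2 powr R * (1/2) ^ (j + 1)"
        by (subst powr_diff, subst powr_realpow) (simp_all add: power_divide field_simps)
      finally show ?thesis .
    qed
    have gb: "norm (- (R + 1) gchoose (j + 1)) = pochhammer (R + 1) (j + 1) / fact (j + 1)"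
      using \<open>R \<ge> 0\<close> by (simp add: gbinomial_pochhammer abs_mult pochhammer_nonneg add.commute del: fact_Suc)
    have "norm (shift_coeff j s * tail_ext 0 (s + of_nat (j + 1)))
      = norm (pochhammer (s - 1) (j + 1)) / fact (j + 2) * norm (s + of_nat j)
          * norm (zeta_tail (s + of_nat (j + 1)))"
      by (simp add: shift_coeff_def norm_mult norm_divide norm_power add_ac del: fact_Suc)
    also have "\<dots> \<le> pochhammer (R + 1) (j + 1) / fact (j + 2) * ((R + 1) * real (j + 2))
          * (C * (2 powr R * (1/2) ^ (j + 1)))"
      using \<open>R \<ge> 0\<close> C(1) poch lin tail
      by (intro mult_mono divide_right_mono mult_nonneg_nonneg divide_nonneg_nonneg pochhammer_nonneg) auto
    also have "\<dots> = M j"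
    proof -
      have "fact (j + 2) = real (j + 2) * fact (j + 1)" by simp
      then show ?thesis
        unfolding M_def K_def gb by (simp add: divide_simps del: fact_Suc)
    qed
    finally show ?thesis .
  qed
  ultimately show ?thesis using that by blast
qed

text \<open>Successive levels agree term by term, since a shift by at least 1 brings the argument
  into the half-plane of the induction hypothesis. The base case is the functional equation.\<close>

lemma tail_ext_Suc_eq:
  assumes "Re s > 1 - real n"
  shows "tail_ext (Suc n) s = tail_ext n s"
  using assms
proof (induction n arbitrary: s)
  case 0
  then show ?case using tail_ext_functional_equation by simp
next
  case (Suc n)
  have "tail_ext (Suc n) (s + of_nat (j + 1)) = tail_ext n (s + of_nat (j + 1))" for j
    by (rule Suc.IH) (use Suc.prems in simp)
  then show ?case
    by (subst (1 2) tail_ext.simps(2)) simp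
qed

lemma tail_ext_eq:
  assumes "Re s > 1 - real n" "n \<le> m"
  shows "tail_ext m s = tail_ext n s"
  using assms(2)
proof (induction rule: dec_induct)
  case (step m)
  then show ?case using tail_ext_Suc_eq[of m s] assms(1) by simp
qed simp

lemma tail_ext_holomorphic: "tail_ext n holomorphic_on {s. Re s > 1 - real n}"
proof (induction n)
  case 0
  show ?case
    by (simp add: zeta_tail_holomorphic holomorphic_intros cong: holomorphic_cong)
next
  case (Suc n)
  let ?S = "{s. Re s > 1 - real (Suc n)}"
  let ?f = "\<lambda>j s. shift_coeff j s * tail_ext n (s + of_nat (j + 1))"
  have "(\<lambda>s. \<Sum>j. ?f j s) holomorphic_on ?S"
  proof (rule holomorphic_uniform_sequence)
    show "open ?S" by (rule open_halfspace_Re_gt)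
    have "(\<lambda>s. tail_ext n (s + of_nat (j + 1))) holomorphic_on ?S" for j
      by (rule holomorphic_on_compose_gen[OF _ Suc.IH, unfolded o_def])
         (auto intro!: holomorphic_intros)
    then show "(\<lambda>s. \<Sum>j<N. ?f j s) holomorphic_on ?S" for N
      unfolding shift_coeff_def pochhammer_prod by (intro holomorphic_intros) auto
    fix s assume s: "s \<in> ?S"
    obtain d where d: "d > 0" "cball s d \<subseteq> ?S"
      using \<open>open ?S\<close> s open_contains_cball by blast
    define R where "R = norm s + d"
    have R: "R \<ge> 0" "\<And>z. z \<in> cball s d \<Longrightarrow> norm z \<le> R"
    proof -
      show "R \<ge> 0" using d(1) by (simp add: R_def)
      show "norm z \<le> R" if "z \<in> cball s d" for z
        using that norm_triangle_sub[of z s] by (auto simp: R_def dist_norm norm_minus_commute)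
    qed
    obtain M where M: "summable M" "\<And>j s. norm s \<le> R \<Longrightarrow> R + 1 \<le> real j \<Longrightarrow>
       norm (shift_coeff j s * tail_ext 0 (s + of_nat (j + 1))) \<le> M j"
      using tail_ext_series_majorant[OF R(1)] by metis
    have majorant: "\<forall>z\<in>cball s d. norm (?f j z) \<le> M j" if "R + 1 \<le> real j" for j
    proof
      fix z assume "z \<in> cball s d"
      then have z: "norm z \<le> R" by (rule R(2))
      \<comment> \<open>Here the shifted argument has real part at least 2, so every level reduces
        to level 0 and one majorant serves all \<open>n\<close>.\<close>
      have "tail_ext n (z + of_nat (j + 1)) = tail_ext 0 (z + of_nat (j + 1))"
        by (rule tail_ext_eq) (use z that abs_Re_le_cmod[of z] in auto)
      then show "norm (?f j z) \<le> M j" using M(2)[OF z that] by simp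
    qed
    \<comment> \<open>Finitely many summands escape the majorant, which does not affect uniform
      convergence.\<close>
    have ev: "\<forall>\<^sub>F j in sequentially. \<forall>z\<in>cball s d. norm (?f j z) \<le> M j"
    proof (intro eventually_sequentiallyI[of "nat \<lceil>R + 1\<rceil>"])
      fix j assume "nat \<lceil>R + 1\<rceil> \<le> j"
      then have "R + 1 \<le> real j" by linarith
      then show "\<forall>z\<in>cball s d. norm (?f j z) \<le> M j" by (rule majorant)
    qed
    show "\<exists>d>0. cball s d \<subseteq> ?S \<and>
        uniform_limit (cball s d) (\<lambda>N s. \<Sum>j<N. ?f j s) (\<lambda>s. \<Sum>j. ?f j s) sequentially"
      by (intro exI[of _ d] conjI d Weierstrass_m_test_ev[OF ev M(1)])
  qed
  then show ?case
    unfolding tail_ext.simps by (intro holomorphic_intros) auto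
qed

lemma zeta_continuation_exists:
  "\<exists>f. f holomorphic_on (- {1}) \<and>
       (\<forall>s. Re s > 1 \<longrightarrow> (\<lambda>n. 1 / (of_nat (Suc n) powr s)) sums f s)"
proof -
  \<comment> \<open>The ceiling gives a level \<open>n\<close> with
    \<open>1 - real n \<le> Re s - 1\<close>, hence one valid at \<open>s\<close>; any other valid
    level has the same value there.\<close>
  define G where "G s = tail_ext (nat \<lceil>2 - Re s\<rceil>) s" for s
  have G: "G s = tail_ext n s" if "Re s > 1 - real n" for n s
  proof (cases "n \<le> nat \<lceil>2 - Re s\<rceil>")
    case True
    then show ?thesis unfolding G_def by (rule tail_ext_eq[OF that])
  next
    case False
    have "Re s > 1 - real (nat \<lceil>2 - Re s\<rceil>)" by linarith
    from tail_ext_eq[OF this, of n] False show ?thesis unfolding G_def by (metis nle_le)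
  qed
  have "G holomorphic_on UNIV"
  proof -
    have "G field_differentiable at s" for s
    proof -
      obtain n where n: "1 - Re s < real n" using reals_Archimedean2 by blast
      have "G holomorphic_on {s. Re s > 1 - real n}"
        using tail_ext_holomorphic by (rule holomorphic_transform) (use G in auto)
      then show ?thesis
        by (rule holomorphic_on_imp_differentiable_at[OF _ open_halfspace_Re_gt]) (use n in simp)
    qed
    then show ?thesis by (simp add: holomorphic_on_def field_differentiable_at_within)
  qed
  \<comment> \<open>Undoing the normalisation of \<open>G\<close> can create a pole only at
    1.\<close>
  then have "(\<lambda>s. 1 + G s / (s - 1)) holomorphic_on (- {1})"
    using holomorphic_on_subset[of G UNIV "- {1}"] by (intro holomorphic_intros) auto
  moreover have "(\<lambda>n. 1 / (of_nat (Suc n) powr s)) sums (1 + G s / (s - 1))" if s: "Re s > 1" for s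
  proof -
    have "s \<noteq> 1" using s by auto
    then have "G s / (s - 1) = zeta_tail s" using G[of 0 s] s by simp
    moreover have "(\<lambda>n. 1 / (of_nat (Suc (Suc n)) powr s)) sums zeta_tail s"
      using zeta_tail_sums[OF s] by (simp add: powr_minus field_simps)
    from sums_Suc[OF this] have "(\<lambda>n. 1 / (of_nat (Suc n) powr s)) sums (zeta_tail s + 1)"
      by simp
    ultimately show ?thesis by (simp add: add.commute)
  qed
  ultimately show ?thesis by blast
qed

text \<open>\<open>zeta\<close> is a choice term, so its defining property becomes available once a
  continuation is known to exist.\<close>

lemma zeta_holomorphic: "zeta holomorphic_on (- {1})"
  using someI_ex[OF zeta_continuation_exists] unfolding zeta_def by blast

lemma continuous_on_zeta_critical_line:
  "continuous_on A (\<lambda>t. zeta (1/2 + \<i> * complex_of_real t))"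
proof (rule continuous_on_compose2[OF holomorphic_on_imp_continuous_on[OF zeta_holomorphic]])
  show "continuous_on A (\<lambda>t. 1/2 + \<i> * complex_of_real t)"
    by (intro continuous_intros)
  show "(\<lambda>t. 1/2 + \<i> * complex_of_real t) ` A \<subseteq> - {1}"
  proof
    fix z assume "z \<in> (\<lambda>t. 1/2 + \<i> * complex_of_real t) ` A"
    then have "Re z = 1/2" by auto
    then show "z \<in> - {1}" by auto
  qed
qed

subsection \<open>Iterates of a ladder and of its inverse\<close>

locale increasing_ladder =
  fixes f :: "real \<Rightarrow> real" and T0 :: real
  assumes strict_mono: "strict_mono_on {T0..} f"
    and cont: "continuous_on {T0..} f"
    and at_top: "filterlim f at_top at_top"
begin

abbreviation g :: "real \<Rightarrow> real" where "g \<equiv> inv_into {T0..} f"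

text \<open>By unboundedness and the intermediate value theorem every value above
  \<open>f T0\<close> is attained, so \<open>g\<close> is a true right inverse there.\<close>

lemma in_image: "f T0 \<le> y \<Longrightarrow> y \<in> f ` {T0..}"
proof -
  assume y: "f T0 \<le> y"
  have "\<forall>\<^sub>F x in at_top. y \<le> f x \<and> T0 \<le> x"
    using at_top by (intro eventually_conj eventually_ge_at_top) (simp add: filterlim_at_top)
  then obtain x where x: "y \<le> f x" "T0 \<le> x"
    by (auto simp: eventually_at_top_linorder)
  have "continuous_on {T0..x} f" by (rule continuous_on_subset[OF cont]) auto
  from IVT'[OF y x this] show ?thesis by auto
qed

lemma g_ge: "f T0 \<le> y \<Longrightarrow> T0 \<le> g y"
  using inv_into_into[OF in_image] by simp

lemma f_g: "f T0 \<le> y \<Longrightarrow> f (g y) = y"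
  by (rule f_inv_into_f[OF in_image])

lemma f_mono: "T0 \<le> x \<Longrightarrow> x \<le> y \<Longrightarrow> f x \<le> f y"
  using strict_mono_onD[OF strict_mono, of x y] by (cases "x = y") auto

text \<open>The comparison from which both the growth and the monotonicity of \<open>g\<close>
  follow.\<close>

lemma le_g:
  assumes "T0 \<le> x" "f x \<le> y"
  shows "x \<le> g y"
proof (rule ccontr)
  assume "\<not> x \<le> g y"
  moreover have y: "f T0 \<le> y" using f_mono[of T0 x] assms by simp
  ultimately have "f (g y) < f x"
    using strict_mono_onD[OF strict_mono, of "g y" x] g_ge assms by auto
  then show False using f_g[OF y] assms by simp
qed

lemma g_at_top: "filterlim g at_top at_top"
  unfolding filterlim_at_top
proof
  fix Z
  show "\<forall>\<^sub>F y in at_top. Z \<le> g y"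
    using eventually_ge_at_top[of "f (max Z T0)"]
    by eventually_elim (use le_g[of "max Z T0"] in auto)
qed

lemma f_funpow_at_top: "filterlim (f ^^ r) at_top at_top"
  by (induction r) (auto simp: id_def o_def intro: filterlim_ident filterlim_compose[OF at_top])

lemma g_funpow_at_top: "filterlim (g ^^ r) at_top at_top"
  by (induction r) (auto simp: id_def o_def intro: filterlim_ident filterlim_compose[OF g_at_top])

lemma eventually_g_funpow_ge: "\<forall>\<^sub>F T in at_top. \<forall>j\<le>q. B \<le> (g ^^ j) T"
proof -
  have "\<forall>\<^sub>F T in at_top. \<forall>j\<in>{..q}. B \<le> (g ^^ j) T"
    using g_funpow_at_top by (intro eventually_ball_finite) (auto simp: filterlim_at_top)
  then show ?thesis by (simp add: Ball_def)
qed

text \<open>Controlling the orbit of the smaller point suffices: the other orbit stays above it, so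
  both remain where \<open>g\<close> inverts \<open>f\<close>.\<close>

lemma g_funpow_mono:
  assumes "\<forall>j\<le>q. max T0 (f T0) \<le> (g ^^ j) x" "x \<le> y" "j \<le> q"
  shows "(g ^^ j) x \<le> (g ^^ j) y"
  using assms(3)
proof (induction j)
  case (Suc j)
  then have "f T0 \<le> (g ^^ j) x" "(g ^^ j) x \<le> (g ^^ j) y" using assms(1) by auto
  then show ?case
    using le_g[of "g ((g ^^ j) x)" "(g ^^ j) y"] g_ge f_g by simp
qed (use assms in simp)

text \<open>Each application of \<open>f\<close> preserves order and strips one \<open>g\<close> off
  both endpoints.\<close>

lemma f_funpow_segment:
  assumes ge: "\<forall>j\<le>q. max T0 (f T0) \<le> (g ^^ j) x" and "x \<le> y" "r \<le> q"
    and t: "t \<in> {(g ^^ q) x..(g ^^ q) y}"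
  shows "(f ^^ r) t \<in> {(g ^^ (q - r)) x..(g ^^ (q - r)) y}"
  using \<open>r \<le> q\<close>
proof (induction r)
  case (Suc r)
  define m where "m = q - Suc r"
  have m: "q - r = Suc m" "m \<le> q" using Suc.prems by (auto simp: m_def)
  have u: "(f ^^ r) t \<in> {g ((g ^^ m) x)..g ((g ^^ m) y)}"
    using Suc m by simp
  have x: "f T0 \<le> (g ^^ m) x" using ge m by simp
  moreover have y: "f T0 \<le> (g ^^ m) y"
    using x g_funpow_mono[OF ge \<open>x \<le> y\<close> m(2)] by simp
  ultimately have "f (g ((g ^^ m) x)) \<le> f ((f ^^ r) t)" "f ((f ^^ r) t) \<le> f (g ((g ^^ m) y))"
    using u g_ge[OF x] by (auto intro!: f_mono)
  then show ?case
    using f_g[OF x] f_g[OF y] by (simp add: m_def)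
qed (use t in simp)

lemma f_funpow_g_funpow:
  assumes "\<forall>j\<le>q. max T0 (f T0) \<le> (g ^^ j) x" "x \<le> y"
  shows "(f ^^ q) ((g ^^ q) x) = x" "(f ^^ q) ((g ^^ q) y) = y"
proof -
  have le: "(g ^^ j) x \<le> (g ^^ j) y" if "j \<le> q" for j
    using g_funpow_mono[OF assms that] .
  have inverse: "(f ^^ j) ((g ^^ j) z) = z" if "\<forall>i\<le>q. f T0 \<le> (g ^^ i) z" "j \<le> q" for z j
    using that(2)
  proof (induction j)
    case (Suc j)
    then have "f (g ((g ^^ j) z)) = (g ^^ j) z" using that(1) by (intro f_g) auto
    then show ?case using Suc by (simp add: funpow_swap1)
  qed simp
  have x: "f T0 \<le> (g ^^ i) x" if "i \<le> q" for i
    using assms(1) that by simp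
  then have y: "f T0 \<le> (g ^^ i) y" if "i \<le> q" for i
    using le[OF that] that order_trans by blast
  show "(f ^^ q) ((g ^^ q) x) = x" "(f ^^ q) ((g ^^ q) y) = y"
    using x y by (auto intro!: inverse)
qed

lemma DERIV_funpow:
  assumes "\<And>t. t > T0 \<Longrightarrow> (f has_real_derivative f' t) (at t)"
    and "\<forall>r<q. (f ^^ r) t > T0"
  shows "((f ^^ q) has_real_derivative (\<Prod>r<q. f' ((f ^^ r) t))) (at t)"
  using assms(2)
proof (induction q)
  case 0
  then show ?case by (simp add: id_def)
next
  case (Suc q)
  then have "((\<lambda>t. f ((f ^^ q) t)) has_real_derivative
      f' ((f ^^ q) t) * (\<Prod>r<q. f' ((f ^^ r) t))) (at t)"
    by (intro DERIV_chain2 assms(1)) auto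
  then show ?case by (simp add: o_def mult.commute)
qed

lemma ln_funpow_ratio:
  assumes "((\<lambda>t. ln (f t) / ln t) \<longlongrightarrow> 1) at_top"
  shows "((\<lambda>t. ln ((f ^^ j) t) / ln t) \<longlongrightarrow> 1) at_top"
proof (induction j)
  case 0
  have "\<forall>\<^sub>F t in at_top. ln ((f ^^ 0) t) / ln t = (1::real)"
    using eventually_gt_at_top[of 1] by eventually_elim simp
  then show ?case by (rule tendsto_eventually)
next
  case (Suc j)
  \<comment> \<open>The ratio for \<open>Suc j\<close> steps is the one-step ratio at
    \<open>(f ^^ j) t\<close> times the ratio for \<open>j\<close> steps.\<close>
  have "((\<lambda>t. ln (f ((f ^^ j) t)) / ln ((f ^^ j) t) * (ln ((f ^^ j) t) / ln t)) \<longlongrightarrow> 1 * 1) at_top"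
    by (intro tendsto_mult Suc filterlim_compose[OF assms f_funpow_at_top])
  moreover have "\<forall>\<^sub>F t in at_top. (f ^^ j) t > 1"
    using f_funpow_at_top by (simp add: filterlim_at_top_dense)
  then have "\<forall>\<^sub>F t in at_top. ln (f ((f ^^ j) t)) / ln ((f ^^ j) t) * (ln ((f ^^ j) t) / ln t)
      = ln ((f ^^ Suc j) t) / ln t"
    by eventually_elim simp
  ultimately show ?case unfolding mult_1 by (rule Lim_transform_eventually)
qed

text \<open>All weights are compared with the logarithm at the last point of the orbit, because for
  \<open>t\<close> in a reverse segment that point lies close to \<open>T\<close>.\<close>

lemma prod_weight_ratio:
  assumes f: "((\<lambda>t. ln (f t) / ln t) \<longlongrightarrow> 1) at_top"
    and \<omega>: "((\<lambda>t. \<omega> t / ln t) \<longlongrightarrow> 1) at_top"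
  shows "((\<lambda>t. (\<Prod>r<q. \<omega> ((f ^^ r) t)) / ln ((f ^^ q) t) ^ q) \<longlongrightarrow> 1) at_top"
proof -
  have "((\<lambda>t. \<omega> ((f ^^ r) t) / ln ((f ^^ q) t)) \<longlongrightarrow> 1) at_top" if "r < q" for r
  proof -
    \<comment> \<open>Here \<open>u\<close> stands for \<open>(f ^^ r) t\<close>, from which
      \<open>q - r\<close> further steps lead to \<open>(f ^^ q) t\<close>.\<close>
    have "((\<lambda>u. (\<omega> u / ln u) / (ln ((f ^^ (q - r)) u) / ln u)) \<longlongrightarrow> 1 / 1) at_top"
      by (intro tendsto_divide \<omega> ln_funpow_ratio f) simp
    moreover have "\<forall>\<^sub>F u in at_top. (\<omega> u / ln u) / (ln ((f ^^ (q - r)) u) / ln u)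
        = \<omega> u / ln ((f ^^ (q - r)) u)"
      using eventually_gt_at_top[of 1] by eventually_elim simp
    ultimately have "((\<lambda>u. \<omega> u / ln ((f ^^ (q - r)) u)) \<longlongrightarrow> 1) at_top"
      unfolding div_by_1 by (rule Lim_transform_eventually)
    from filterlim_compose[OF this f_funpow_at_top[of r]] that show ?thesis
      by (simp flip: funpow_add[THEN fun_cong, unfolded o_apply])
  qed
  then have "((\<lambda>t. \<Prod>r<q. \<omega> ((f ^^ r) t) / ln ((f ^^ q) t)) \<longlongrightarrow> (\<Prod>r<q. 1)) at_top"
    by (intro tendsto_prod) auto
  then show ?thesis by (simp add: prod_dividef)
qed

end

section \<open>Logarithmic asymptotics of the ladder and of its weight\<close>

lemma ln_ratio_tendsto_1:
  fixes f :: "real \<Rightarrow> real"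
  assumes "(\<lambda>t. t - f t) \<in> O(\<lambda>t. t / ln t)"
  shows "((\<lambda>t. ln (f t) / ln t) \<longlongrightarrow> 1) at_top"
proof -
  have "(\<lambda>t::real. t / ln t) \<in> o(\<lambda>t. t)" by real_asymp
  from landau_o.big_small_trans[OF assms this]
  have "((\<lambda>t. (t - f t) / t) \<longlongrightarrow> 0) at_top" by (rule smalloD_tendsto)
  \<comment> \<open>This is the quotient \<open>f t / t\<close>; as it tends to 1,
    \<open>ln (f t)\<close> and \<open>ln t\<close> differ by a term tending to 0.\<close>
  then have "((\<lambda>t. 1 - (t - f t) / t) \<longlongrightarrow> 1 - 0) at_top"
    by (intro tendsto_diff tendsto_const)
  then have lim: "((\<lambda>t. 1 - (t - f t) / t) \<longlongrightarrow> 1) at_top" by simp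
  then have "((\<lambda>t. ln (1 - (t - f t) / t)) \<longlongrightarrow> ln 1) at_top"
    by (rule tendsto_ln) simp
  moreover have "((\<lambda>t::real. 1 / ln t) \<longlongrightarrow> 0) at_top" by real_asymp
  ultimately have "((\<lambda>t. 1 + ln (1 - (t - f t) / t) * (1 / ln t)) \<longlongrightarrow> 1 + ln 1 * 0) at_top"
    by (intro tendsto_add tendsto_mult tendsto_const)
  moreover have "\<forall>\<^sub>F t in at_top. 1 + ln (1 - (t - f t) / t) * (1 / ln t) = ln (f t) / ln t"
    using order_tendstoD(1)[OF lim zero_less_one] eventually_gt_at_top[of 1]
  proof eventually_elim
    case (elim t)
    have "1 - (t - f t) / t = f t / t" using elim by (simp add: field_simps)
    moreover have "0 < f t"
      using elim calculation by (simp add: zero_less_divide_iff)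
    then have "ln (f t / t) = ln (f t) - ln t"
      using elim by (simp add: ln_div)
    ultimately show ?case using elim by (simp add: field_simps)
  qed
  ultimately have "((\<lambda>t. ln (f t) / ln t) \<longlongrightarrow> 1 + ln 1 * 0) at_top"
    by (rule Lim_transform_eventually)
  then show ?thesis by simp
qed

lemma weight_ratio_tendsto_1:
  fixes \<omega> :: "real \<Rightarrow> real"
  assumes "(\<lambda>t. \<omega> t / ln t - 1) \<in> O(\<lambda>t. ln (ln t) / ln t)"
  shows "((\<lambda>t. \<omega> t / ln t) \<longlongrightarrow> 1) at_top"
proof -
  have "(\<lambda>t::real. ln (ln t) / ln t) \<in> o(\<lambda>t. 1)" by real_asymp
  from landau_o.big_small_trans[OF assms this]
  have "((\<lambda>t. \<omega> t / ln t - 1) \<longlongrightarrow> 0) at_top" by (auto dest: smalloD_tendsto)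
  then show ?thesis by (rule LIM_zero_cancel)
qed

section \<open>Bounds and asymptotics of the integral over a reverse segment\<close>

lemma integral_bounds_of_density:
  fixes h w :: "real \<Rightarrow> real"
  assumes w: "(w has_integral d) {a..b}" and h: "h integrable_on {a..b}"
    and "\<And>t. t \<in> {a..b} \<Longrightarrow> l * w t \<le> h t" "\<And>t. t \<in> {a..b} \<Longrightarrow> h t \<le> u * w t"
  shows "l * d \<le> integral {a..b} h" "integral {a..b} h \<le> u * d"
  using assms has_integral_mult_right[OF w, of l] has_integral_mult_right[OF w, of u]
    integrable_integral[OF h] by (auto intro: has_integral_le)

text \<open>The derivative is two-sided, strictly inside the half-line, so that the chain rule
  applies to iterates.\<close>

locale zeta_ladder = increasing_ladder +
  fixes \<omega> :: "real \<Rightarrow> real"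
  assumes deriv: "t > T0 \<Longrightarrow>
      (f has_real_derivative (cmod (zeta (1/2 + \<i> * complex_of_real t)))\<^sup>2 / \<omega> t) (at t)"
    and ln_ratio: "((\<lambda>t. ln (f t) / ln t) \<longlongrightarrow> 1) at_top"
    and weight_ratio: "((\<lambda>t. \<omega> t / ln t) \<longlongrightarrow> 1) at_top"
begin

definition integrand :: "nat \<Rightarrow> real \<Rightarrow> real" where
  "integrand q t = (\<Prod>r<q. (cmod (zeta (1/2 + \<i> * complex_of_real ((f ^^ r) t))))\<^sup>2)"

lemma eventually_weight_pos: "\<forall>\<^sub>F t in at_top. \<omega> t > 0"
  using order_tendstoD(1)[OF weight_ratio zero_less_one] eventually_gt_at_top[of 1]
  by eventually_elim (auto simp: zero_less_divide_iff)

text \<open>The weight product is trapped by powers of the logarithm at \<open>(f ^^ q) t\<close>, a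
  point of \<open>[T, T + 1]\<close>; this explains \<open>T + 1\<close> in the upper bound.\<close>

lemma integral_bounds:
  assumes \<epsilon>: "0 < \<epsilon>" "\<epsilon> < 1"
  shows "\<forall>\<^sub>F T in at_top.
    integral (reverse_segment T0 f p q T) (integrand q) \<in>
      {(1 - \<epsilon>) * ln T ^ q * ln T powi (- int p) .. (1 + \<epsilon>) * ln (T + 1) ^ q * ln T powi (- int p)}"
proof -
  let ?W = "\<lambda>t. \<Prod>r<q. \<omega> ((f ^^ r) t)"
  have "\<forall>\<^sub>F t in at_top. 1 - \<epsilon> < ?W t / ln ((f ^^ q) t) ^ q \<and> ?W t / ln ((f ^^ q) t) ^ q < 1 + \<epsilon>"
    using prod_weight_ratio[OF ln_ratio weight_ratio, of q] \<epsilon>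
    by (intro eventually_conj order_tendstoD[where y = 1]) auto
  from eventually_conj[OF eventually_weight_pos this] obtain B where
    B: "\<And>t. t \<ge> B \<Longrightarrow> \<omega> t > 0 \<and>
      1 - \<epsilon> < ?W t / ln ((f ^^ q) t) ^ q \<and> ?W t / ln ((f ^^ q) t) ^ q < 1 + \<epsilon>"
    unfolding eventually_at_top_linorder by blast
  \<comment> \<open>Beyond \<open>B\<close> the weights are controlled, beyond \<open>T0 + 1\<close>
    the derivative is two-sided, beyond \<open>f T0\<close> the inverse is genuine.\<close>
  define B' where "B' = max B (max (T0 + 1) (f T0))"
  show ?thesis
    \<comment> \<open>\<open>T \<ge> exp 1\<close> gives \<open>ln T \<ge> 1\<close>, hence an
      increment of at most 1.\<close>
    using eventually_g_funpow_ge[of q B'] eventually_ge_at_top[of "exp 1"]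
  proof eventually_elim
    case (elim T)
    define d where "d = ln T powi (- int p)"
    have "exp 1 > (1::real)" by simp
    with elim(2) have "T > 1" by linarith
    with elim(2) have T: "T > 1" "ln T \<ge> 1" by (simp_all add: ln_ge_iff)
    have "ln T ^ p \<ge> 1" using T by simp
    then have d: "0 < d" "d \<le> 1"
      using T by (auto simp: d_def power_int_minus field_simps)
    define a b where "a = (g ^^ q) T" and "b = (g ^^ q) (T + d)"
    have seg: "reverse_segment T0 f p q T = {a..b}"
      by (simp add: reverse_segment_def reverse_iterate_def a_def b_def d_def)
    have ge: "\<forall>j\<le>q. max T0 (f T0) \<le> (g ^^ j) T" using elim(1) by (auto simp: B'_def)
    have le: "T \<le> T + d" using d by simp
    have "a \<le> b" unfolding a_def b_def using g_funpow_mono[OF ge le, of q] by simp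
    have orbit: "B' \<le> (f ^^ r) t" if "t \<in> {a..b}" "r \<le> q" for t r
    proof -
      have "B' \<le> (g ^^ (q - r)) T" using elim(1) by simp
      also have "\<dots> \<le> (f ^^ r) t"
        using f_funpow_segment[OF ge le that(2), of t] that(1) unfolding a_def b_def by simp
      finally show ?thesis .
    qed
    have top: "(f ^^ q) t \<in> {T..T + d}" if "t \<in> {a..b}" for t
      using f_funpow_segment[OF ge le order_refl, of t] that unfolding a_def b_def by simp
    define w where "w t = (\<Prod>r<q. (cmod (zeta (1/2 + \<i> * complex_of_real ((f ^^ r) t))))\<^sup>2
        / \<omega> ((f ^^ r) t))" for t
    \<comment> \<open>The case \<open>r = q\<close> feeds the fundamental theorem of calculus, the
      cases \<open>r < q\<close> the continuity of the integrand.\<close>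
    have der: "((f ^^ r) has_real_derivative (\<Prod>i<r. (cmod (zeta (1/2 + \<i> * complex_of_real ((f ^^ i) t))))\<^sup>2
        / \<omega> ((f ^^ i) t))) (at t)" if t: "t \<in> {a..b}" and "r \<le> q" for t r
    proof (rule DERIV_funpow[OF deriv])
      have "T0 < (f ^^ i) t" if "i < r" for i
        using orbit[OF t, of i] that \<open>r \<le> q\<close> by (simp add: B'_def)
      then show "\<forall>i<r. T0 < (f ^^ i) t" by blast
    qed
    \<comment> \<open>\<open>w\<close> is the derivative of \<open>f ^^ q\<close>, which sends the
      endpoints to \<open>T\<close> and \<open>T + d\<close>.\<close>
    have "(w has_integral ((f ^^ q) b - (f ^^ q) a)) {a..b}"
      using \<open>a \<le> b\<close> der[OF _ order_refl] unfolding w_def[abs_def]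
      by (intro fundamental_theorem_of_calculus)
         (auto simp flip: has_real_derivative_iff_has_vector_derivative
               intro: has_field_derivative_at_within)
    then have w: "(w has_integral d) {a..b}"
      using f_funpow_g_funpow[OF ge le] by (simp add: a_def b_def)
    have "integrand q integrable_on {a..b}"
      unfolding integrand_def[abs_def]
    proof (intro integrable_continuous_interval continuous_intros)
      fix r assume "r \<in> {..<q}"
      then have "continuous_on {a..b} (f ^^ r)"
        by (intro continuous_at_imp_continuous_on ballI DERIV_isCont[OF der]) auto
      then show "continuous_on {a..b} (\<lambda>t. zeta (1/2 + \<i> * complex_of_real ((f ^^ r) t)))"
        by (rule continuous_on_compose2[OF continuous_on_zeta_critical_line[of UNIV]]) simp
    qed
    have factor: "integrand q t = ?W t * w t" and w_nonneg: "0 \<le> w t" if "t \<in> {a..b}" for t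
    proof -
      have pos: "\<omega> ((f ^^ r) t) > 0" if "r < q" for r
        using orbit[OF \<open>t \<in> {a..b}\<close>, of r] that by (intro B[THEN conjunct1]) (auto simp: B'_def)
      show "integrand q t = ?W t * w t"
        unfolding integrand_def w_def prod.distrib[symmetric]
        by (rule prod.cong) (use pos in \<open>force+\<close>)
      show "0 \<le> w t"
        unfolding w_def by (intro prod_nonneg divide_nonneg_pos) (use pos in auto)
    qed
    have bounds: "(1 - \<epsilon>) * ln T ^ q \<le> ?W t" "?W t \<le> (1 + \<epsilon>) * ln (T + 1) ^ q"
      if t: "t \<in> {a..b}" for t
    proof -
      let ?l = "ln ((f ^^ q) t)"
      have l: "ln T \<le> ?l" "?l \<le> ln (T + 1)" using top[OF t] T d by auto
      then have powers: "ln T ^ q \<le> ?l ^ q" "?l ^ q \<le> ln (T + 1) ^ q"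
        using T by (auto intro!: power_mono)
      have "?l ^ q > 0" using l T by simp
      moreover have "1 - \<epsilon> < ?W t / ?l ^ q" "?W t / ?l ^ q < 1 + \<epsilon>"
        using B[of t] orbit[OF t, of 0] by (auto simp: B'_def)
      ultimately have "(1 - \<epsilon>) * ?l ^ q \<le> ?W t" "?W t \<le> (1 + \<epsilon>) * ?l ^ q"
        by (auto simp only: pos_less_divide_eq pos_divide_less_eq intro: less_imp_le)
      moreover have "(1 - \<epsilon>) * ln T ^ q \<le> (1 - \<epsilon>) * ?l ^ q"
        "(1 + \<epsilon>) * ?l ^ q \<le> (1 + \<epsilon>) * ln (T + 1) ^ q"
        using powers \<epsilon> by (auto intro!: mult_left_mono)
      ultimately show "(1 - \<epsilon>) * ln T ^ q \<le> ?W t" "?W t \<le> (1 + \<epsilon>) * ln (T + 1) ^ q"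
        by linarith+
    qed
    \<comment> \<open>The bounds are multiples of \<open>w t\<close> rather than bounds on a
      quotient, since \<open>w\<close> vanishes wherever one of the zeta factors does.\<close>
    have "(1 - \<epsilon>) * ln T ^ q * w t \<le> integrand q t"
      "integrand q t \<le> (1 + \<epsilon>) * ln (T + 1) ^ q * w t" if t: "t \<in> {a..b}" for t
      unfolding factor[OF t] by (intro mult_right_mono bounds[OF t] w_nonneg[OF t])+
    from integral_bounds_of_density[OF w \<open>integrand q integrable_on {a..b}\<close> this]
    show ?case unfolding seg d_def by simp
  qed
qed

lemma integral_asymp:
  "(\<lambda>T. integral (reverse_segment T0 f p q T) (integrand q))
           \<sim>[at_top] (\<lambda>T. ln T powi (int q - int p))"
proof (rule asymp_equivI', rule order_tendstoI)
  let ?I = "\<lambda>T. integral (reverse_segment T0 f p q T) (integrand q)"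
  have split: "ln T powi (int q - int p) = ln T ^ q * ln T powi (- int p)" "ln T ^ q > 0"
    "ln T powi (- int p) > 0" if "T > 1" for T :: real
    using that power_int_add[of "ln T" "int q" "- int p"] by auto
  fix a :: real
  {
    assume "a < 1"
    \<comment> \<open>Half the gap makes \<open>a < 1 - \<epsilon>\<close> strict; the cap 1/2 keeps
      \<epsilon> below 1.\<close>
    define \<epsilon> where "\<epsilon> = min (1/2) ((1 - a) / 2)"
    have \<epsilon>: "0 < \<epsilon>" "\<epsilon> < 1" "a < 1 - \<epsilon>" using \<open>a < 1\<close> by (auto simp: \<epsilon>_def min_def field_simps)
    show "\<forall>\<^sub>F T in at_top. a < ?I T / ln T powi (int q - int p)"
      using integral_bounds[OF \<epsilon>(1,2), of p q] eventually_gt_at_top[of 1]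
    proof eventually_elim
      case (elim T)
      have "1 - \<epsilon> \<le> ?I T / ln T powi (int q - int p)"
        using elim split[of T] by (simp add: field_simps)
      then show ?case using \<epsilon> by linarith
    qed
  next
    assume "a > 1"
    \<comment> \<open>Two factors \<open>1 + \<epsilon>\<close> must fit below \<open>a\<close>: one
      for the weights, one for replacing \<open>ln (T + 1)\<close> by \<open>ln T\<close>. Their
      product is less than \<open>1 + 3 * \<epsilon>\<close>.\<close>
    define \<epsilon> where "\<epsilon> = min (1/2) ((a - 1) / 4)"
    have \<epsilon>: "0 < \<epsilon>" "\<epsilon> < 1" "4 * \<epsilon> \<le> a - 1" using \<open>a > 1\<close> by (auto simp: \<epsilon>_def min_def)
    have "\<epsilon> * \<epsilon> < \<epsilon>" using \<epsilon> by simp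
    moreover have "(1 + \<epsilon>) * (1 + \<epsilon>) = 1 + 2 * \<epsilon> + \<epsilon> * \<epsilon>" by (simp add: algebra_simps)
    ultimately have sq: "(1 + \<epsilon>) * (1 + \<epsilon>) < a" using \<epsilon> by linarith
    have "((\<lambda>T::real. ln (T + 1) / ln T) \<longlongrightarrow> 1) at_top" by real_asymp
    from tendsto_power[OF this, of q]
    have "((\<lambda>T::real. (ln (T + 1) / ln T) ^ q) \<longlongrightarrow> 1) at_top" by simp
    from order_tendstoD(2)[OF this, of "1 + \<epsilon>"] \<epsilon>
    have "\<forall>\<^sub>F T::real in at_top. (ln (T + 1) / ln T) ^ q < 1 + \<epsilon>" by simp
    with integral_bounds[OF \<epsilon>(1,2), of p q] eventually_gt_at_top[of 1]
    show "\<forall>\<^sub>F T in at_top. ?I T / ln T powi (int q - int p) < a"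
    proof eventually_elim
      case (elim T)
      have "?I T / ln T powi (int q - int p) \<le> (1 + \<epsilon>) * (ln (T + 1) / ln T) ^ q"
        using elim(1,2) split[of T] by (simp add: power_divide field_simps)
      also have "\<dots> \<le> (1 + \<epsilon>) * (1 + \<epsilon>)"
        using elim(3) \<epsilon> by (intro mult_left_mono) auto
      finally show ?case using sq by linarith
    qed
  }
qed

end

section \<open>From the standing facts to the theorem\<close>

lemma ladder_standing_facts_imp_zeta_ladder:
  assumes "ladder_standing_facts T0 f"
  obtains \<omega> where "zeta_ladder f T0 \<omega>"
proof -
  from assms obtain f' \<omega> where *:
    "strict_mono_on {T0..} f" "filterlim f at_top at_top"
    "(\<lambda>t. t - f t) \<sim>[at_top] (\<lambda>t. (1 - euler_mascheroni) * (t / ln t))"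
    "\<forall>t\<ge>T0. (f has_real_derivative f' t) (at t within {T0..})"
    "\<forall>t\<ge>T0. f' t = (cmod (zeta (1/2 + \<i> * complex_of_real t)))\<^sup>2 / \<omega> t"
    "(\<lambda>t. \<omega> t / ln t - 1) \<in> O(\<lambda>t. ln (ln t) / ln t)"
    unfolding ladder_standing_facts_def by blast
  have "zeta_ladder f T0 \<omega>"
  proof
    show "strict_mono_on {T0..} f" "filterlim f at_top at_top" by fact+
    show "continuous_on {T0..} f"
      using *(4) by (auto intro!: DERIV_continuous_on)
    show "(f has_real_derivative (cmod (zeta (1/2 + \<i> * complex_of_real t)))\<^sup>2 / \<omega> t) (at t)"
      if "t > T0" for t
    proof -
      have "(f has_real_derivative f' t) (at t within {T0..})" using *(4) that by simp
      \<comment> \<open>At an interior point the derivative within the half-line is the two-sided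
        one.\<close>
      moreover have "at t within {T0..} = at t"
        using that by (intro at_within_interior) simp
      ultimately show ?thesis using *(5) that by simp
    qed
    have "(\<lambda>t. t - f t) \<in> O(\<lambda>t. t / ln t)"
      using asymp_equiv_imp_bigo[OF *(3)] 
      by (rule landau_o.big_trans, intro bigoI[of _ "\<bar>1 - euler_mascheroni\<bar>"]) (simp add: abs_mult)
    then show "((\<lambda>t. ln (f t) / ln t) \<longlongrightarrow> 1) at_top" by (rule ln_ratio_tendsto_1)
    show "((\<lambda>t. \<omega> t / ln t) \<longlongrightarrow> 1) at_top" by (rule weight_ratio_tendsto_1[OF *(6)])
  qed
  then show thesis by (rule that)
qed

text \<open>For \<open>T > 1\<close> the increment is positive, so the endpoints are ordered and
  \<open>f_funpow_segment\<close> applies once the reverse orbit of \<open>T\<close> is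
  large.\<close>

lemma (in increasing_ladder) eventually_funpow_in_reverse_segment:
  "\<forall>\<^sub>F T in at_top. \<forall>t\<in>reverse_segment T0 f p q T. \<forall>r\<le>q.
     (f ^^ r) t \<in> reverse_segment T0 f p (q - r) T"
  using eventually_g_funpow_ge[of q "max T0 (f T0)"] eventually_gt_at_top[of 1]
proof eventually_elim
  case (elim T)
  have "T \<le> T + ln T powi (- int p)" using elim(2) by simp
  from f_funpow_segment[OF elim(1) this] show ?case
    unfolding reverse_segment_def reverse_iterate_def by blast
qed

theorem mainTheorem1:
  fixes \<mu> \<phi> :: "real \<Rightarrow> real" and T0 :: real and k0 k :: nat
  defines "\<phi>1 \<equiv> jacobs_ladder \<phi>"
  assumes "admissible_mu \<mu>"
    and "eventually (ladder_equation \<mu> \<phi>) at_top"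
    and "ladder_standing_facts T0 \<phi>1"
    and "1 \<le> k" and "k \<le> k0"
  shows "\<forall>p\<in>{1..k}. \<forall>q\<in>{1..k}.
    (\<lambda>T. integral (reverse_segment T0 \<phi>1 p q T)
           (\<lambda>t. \<Prod>r<q. (cmod (zeta (1/2 + \<i> * complex_of_real ((\<phi>1 ^^ r) t))))\<^sup>2))
      \<sim>[at_top] (\<lambda>T. ln T powi (int q - int p)) \<and>
    (\<forall>\<^sub>F T in at_top. \<forall>t\<in>reverse_segment T0 \<phi>1 p q T. \<forall>r\<le>q.
       (\<phi>1 ^^ r) t \<in> reverse_segment T0 \<phi>1 p (q - r) T)"
proof -
  obtain \<omega> where "zeta_ladder \<phi>1 T0 \<omega>"
    using ladder_standing_facts_imp_zeta_ladder assms(4) by blast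
  then interpret zeta_ladder \<phi>1 T0 \<omega> .
  show ?thesis
    using integral_asymp[unfolded integrand_def[abs_def]] eventually_funpow_in_reverse_segment by auto
qed

end
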